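(* Let $M\mapsto M^*$ be the translation from the untyped delimited control calculus to the untyped monadic reflection calculus that is homomorphic on all core constructs and satisfies $(\mathcal{S}_0k.M)^*=\mathtt{reflect}(\lambda k.M^* )$ and $\langle M\mid x.N\rangle^*=(\mathtt{reify}_{\mathrm{Cont}}\,M^* )\,\{\lambda x.N^*\}$, where $\mathrm{Cont}=\mathtt{where}\{\mathtt{return}\,x=\lambda c.\,c!\,x;\ m\gg\!=f=\lambda c.\,m!\,\{\lambda y.\,f!\,y\,c\}\}$. Then for all computations $M,N$ of the delimited control calculus, $M\to N$ implies $M^*\rightsquigarrow^{+}N^*$.
   Context: Core syntax (shared). Values $V ::= x \mid () \mid (V_1,V_2) \mid \ell\,V \mid \{M\}$; computations $M,N ::= \mathtt{let}\,(x,y)=V\,\mathtt{in}\,M \mid \mathtt{case}\,V\,\mathtt{of}\,\{\ell_i x_i\mapsto M_i\}_i \mid V! \mid \mathtt{return}\,V \mid \mathtt{let}\,x\Leftarrow M\,\mathtt{in}\,N \mid \lambda x.M \mid M\,V \mid \langle M_1,M_2\rangle \mid \mathrm{prj}_i M$. Core $\beta$-rules: $\mathtt{let}\,(x,y)=(V_1,V_2)\,\mathtt{in}\,M \to_\beta M[V_1/x,V_2/y]$; $\mathtt{case}\,\ell_j V\,\mathtt{of}\,\{\dots\ell_j x_j\mapsto M_j\dots\}\to_\beta M_j[V/x_j]$; $\{M\}!\to_\beta M$; $\mathtt{let}\,x\Leftarrow\mathtt{return}\,V\,\mathtt{in}\,N\to_\beta N[V/x]$; $(\lambda x.M)V\to_\beta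 M[V/x]$; $\mathrm{prj}_i\langle M_1,M_2\rangle\to_\beta M_i$. Basic frames $B ::= \mathtt{let}\,x\Leftarrow[\,]\,\mathtt{in}\,N\mid[\,]\,V\mid\mathrm{prj}_i[\,]$; hoisting contexts $\mathcal{H}::=[\,]\mid\mathcal{H}[B]$. In each calculus $M\to N$ iff $M=K[M']$, $N=K[N']$ with $M'\to_\beta N'$ and $K$ an evaluation context of that calculus. Delimited control calculus: adds computations $\mathcal{S}_0k.M$ and $\langle M\mid x.N\rangle$; evaluation contexts $K::=[\,]\mid K[B]\mid K[\langle[\,]\mid x.N\rangle]$; extra rules $\langle\mathtt{return}\,V\mid x.N\rangle\to_\beta N[V/x]$ and $\langle\mathcal{H}[\mathcal{S}_0k.M]\mid x.N\rangle\to_\beta M[\{\lambda y.\langle\mathcal{H}[\mathtt{return}\,y]\mid x.N\rangle\}/k]$. Monadic reflection calculus: monad terms $T=\mathtt{where}\{\mathtt{return}\,x=N_u;\ y\gg\!=f=N_b\}$; adds computations $\mathtt{reflect}\,N$ and $\mathtt{reify}_T\,M$; evaluation contexts $K::=[\,]\mid K[B]\mid K[\mathtt{reify}_T[\,]]$; extra rules $\mathtt{reify}_T(\mathtt{return}\,V)\to_\beta N_u[V/x]$ and $\mathtt{reify}_T\,\mathcal{H}[\mathtt{reflect}\,N]\to_\beta N_b[\{N\}/y,\{\lambda z.\mathtt{reify}_T\,\mathcal{H}[\mathtt{return}\,z]\}/f]$. $\rightsquigarrow$ is the smallest relation on terms of the target calculus containing $\to_\beta$ and closed under all term-forming constructs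 (so reduction may occur anywhere, including under binders); $\rightsquigarrow^{+}$ is its transitive closure. The translation is hygienic (bound variables it introduces are fresh). *)

theory Defs
  imports Main "HOL-Library.Finite_Map"
begin

text \<open>
  Terms are taken up to renaming of bound variables by means of de Bruijn indices.  A construct that
  binds two variables gives index 1 to the first one and index 0 to the second one.  The labels
  form an arbitrary type \<open>'l\<close>, and the branches of a case form a finite map from labels, so that
  there is at most one branch for each label.
\<close>

section \<open>Delimited control\<close>

text \<open>
  Binding structure: \<open>DSplit V M\<close> is \<open>let (x, y) = V in M\<close> and binds two variables in \<open>M\<close>;
  each branch of \<open>DCase\<close>, the second argument of \<open>DLet\<close>, the body of \<open>DLam\<close>, the body of
  \<open>DShift0\<close> (the variable \<open>k\<close>), and the second argument of \<open>DReset M N\<close>, which is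
  \<open>\<langle>M | x. N\<rangle>\<close>, bind one.  \<open>DWith M N\<close> is the computation pair \<open>\<langle>M, N\<rangle>\<close>.
\<close>

datatype 'l dval =
    DVar nat
  | DUnit
  | DPair "'l dval" "'l dval"
  | DInj 'l "'l dval"
  | DThunk "'l dcomp"
and 'l dcomp =
    DSplit "'l dval" "'l dcomp"
  | DCase "'l dval" "('l, 'l dcomp) fmap"
  | DForce "'l dval"
  | DReturn "'l dval"
  | DLet "'l dcomp" "'l dcomp"
  | DLam "'l dcomp"
  | DApp "'l dcomp" "'l dval"
  | DWith "'l dcomp" "'l dcomp"
  | DPrj1 "'l dcomp"
  | DPrj2 "'l dcomp"
  | DShift0 "'l dcomp"
  | DReset "'l dcomp" "'l dcomp"

text \<open>\<open>upr\<close>, and for substitutions \<open>dups\<close> and \<open>mups\<close>, take a map under one binder.\<close>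

definition upr :: "(nat \<Rightarrow> nat) \<Rightarrow> nat \<Rightarrow> nat" where
  "upr r = case_nat 0 (Suc \<circ> r)"

primrec drenv :: "(nat \<Rightarrow> nat) \<Rightarrow> 'l dval \<Rightarrow> 'l dval"
  and drenc :: "(nat \<Rightarrow> nat) \<Rightarrow> 'l dcomp \<Rightarrow> 'l dcomp" where
  "drenv r (DVar n) = DVar (r n)"
| "drenv r DUnit = DUnit"
| "drenv r (DPair V W) = DPair (drenv r V) (drenv r W)"
| "drenv r (DInj l V) = DInj l (drenv r V)"
| "drenv r (DThunk M) = DThunk (drenc r M)"
| "drenc r (DSplit V M) = DSplit (drenv r V) (drenc (upr (upr r)) M)"
| "drenc r (DCase V bs) = DCase (drenv r V) (fmmap (drenc (upr r)) bs)"
| "drenc r (DForce V) = DForce (drenv r V)"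
| "drenc r (DReturn V) = DReturn (drenv r V)"
| "drenc r (DLet M N) = DLet (drenc r M) (drenc (upr r) N)"
| "drenc r (DLam M) = DLam (drenc (upr r) M)"
| "drenc r (DApp M V) = DApp (drenc r M) (drenv r V)"
| "drenc r (DWith M N) = DWith (drenc r M) (drenc r N)"
| "drenc r (DPrj1 M) = DPrj1 (drenc r M)"
| "drenc r (DPrj2 M) = DPrj2 (drenc r M)"
| "drenc r (DShift0 M) = DShift0 (drenc (upr r) M)"
| "drenc r (DReset M N) = DReset (drenc r M) (drenc (upr r) N)"

definition dups :: "(nat \<Rightarrow> 'l dval) \<Rightarrow> nat \<Rightarrow> 'l dval" where
  "dups s = case_nat (DVar 0) (drenv Suc \<circ> s)"

primrec dsubstv :: "(nat \<Rightarrow> 'l dval) \<Rightarrow> 'l dval \<Rightarrow> 'l dval"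
  and dsubstc :: "(nat \<Rightarrow> 'l dval) \<Rightarrow> 'l dcomp \<Rightarrow> 'l dcomp" where
  "dsubstv s (DVar n) = s n"
| "dsubstv s DUnit = DUnit"
| "dsubstv s (DPair V W) = DPair (dsubstv s V) (dsubstv s W)"
| "dsubstv s (DInj l V) = DInj l (dsubstv s V)"
| "dsubstv s (DThunk M) = DThunk (dsubstc s M)"
| "dsubstc s (DSplit V M) = DSplit (dsubstv s V) (dsubstc (dups (dups s)) M)"
| "dsubstc s (DCase V bs) = DCase (dsubstv s V) (fmmap (dsubstc (dups s)) bs)"
| "dsubstc s (DForce V) = DForce (dsubstv s V)"
| "dsubstc s (DReturn V) = DReturn (dsubstv s V)"
| "dsubstc s (DLet M N) = DLet (dsubstc s M) (dsubstc (dups s) N)"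
| "dsubstc s (DLam M) = DLam (dsubstc (dups s) M)"
| "dsubstc s (DApp M V) = DApp (dsubstc s M) (dsubstv s V)"
| "dsubstc s (DWith M N) = DWith (dsubstc s M) (dsubstc s N)"
| "dsubstc s (DPrj1 M) = DPrj1 (dsubstc s M)"
| "dsubstc s (DPrj2 M) = DPrj2 (dsubstc s M)"
| "dsubstc s (DShift0 M) = DShift0 (dsubstc (dups s) M)"
| "dsubstc s (DReset M N) = DReset (dsubstc s M) (dsubstc (dups s) N)"

text \<open>\<open>dsubst2 V W M\<close> is \<open>M[V/x, W/y]\<close>, where \<open>x\<close> is index 1 and \<open>y\<close> is index 0.\<close>

definition dsubst1 :: "'l dval \<Rightarrow> 'l dcomp \<Rightarrow> 'l dcomp" where
  "dsubst1 V = dsubstc (case_nat V DVar)"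

definition dsubst2 :: "'l dval \<Rightarrow> 'l dval \<Rightarrow> 'l dcomp \<Rightarrow> 'l dcomp" where
  "dsubst2 V W = dsubstc (case_nat W (case_nat V DVar))"

text \<open>
  Holes of frames and contexts are not under binders, so plugging needs no shifting; the context
  itself is renamed when it is moved under a binder.
\<close>

datatype 'l dframe =
    DFLet "'l dcomp"
  | DFApp "'l dval"
  | DFPrj1
  | DFPrj2

primrec dplug_frame :: "'l dframe \<Rightarrow> 'l dcomp \<Rightarrow> 'l dcomp" where
  "dplug_frame (DFLet N) M = DLet M N"
| "dplug_frame (DFApp V) M = DApp M V"
| "dplug_frame DFPrj1 M = DPrj1 M"
| "dplug_frame DFPrj2 M = DPrj2 M"

primrec dren_frame :: "(nat \<Rightarrow> nat) \<Rightarrow> 'l dframe \<Rightarrow> 'l dframe" where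
  "dren_frame r (DFLet N) = DFLet (drenc (upr r) N)"
| "dren_frame r (DFApp V) = DFApp (drenv r V)"
| "dren_frame r DFPrj1 = DFPrj1"
| "dren_frame r DFPrj2 = DFPrj2"

datatype 'l dhoist = DHHole | DHFrame "'l dhoist" "'l dframe"

primrec dplug_hoist :: "'l dhoist \<Rightarrow> 'l dcomp \<Rightarrow> 'l dcomp" where
  "dplug_hoist DHHole M = M"
| "dplug_hoist (DHFrame H B) M = dplug_hoist H (dplug_frame B M)"

primrec dren_hoist :: "(nat \<Rightarrow> nat) \<Rightarrow> 'l dhoist \<Rightarrow> 'l dhoist" where
  "dren_hoist r DHHole = DHHole"
| "dren_hoist r (DHFrame H B) = DHFrame (dren_hoist r H) (dren_frame r B)"

inductive dbeta :: "'l dcomp \<Rightarrow> 'l dcomp \<Rightarrow> bool" where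
  split: "dbeta (DSplit (DPair V W) M) (dsubst2 V W M)"
| case_of: "fmlookup bs l = Some M \<Longrightarrow> dbeta (DCase (DInj l V) bs) (dsubst1 V M)"
| force: "dbeta (DForce (DThunk M)) M"
| let_return: "dbeta (DLet (DReturn V) N) (dsubst1 V N)"
| app: "dbeta (DApp (DLam M) V) (dsubst1 V M)"
| prj1: "dbeta (DPrj1 (DWith M N)) M"
| prj2: "dbeta (DPrj2 (DWith M N)) N"
| reset_return: "dbeta (DReset (DReturn V) N) (dsubst1 V N)"
| reset_shift0:
    "dbeta (DReset (dplug_hoist H (DShift0 M)) N)
       (dsubst1
          (DThunk (DLam (DReset (dplug_hoist (dren_hoist Suc H) (DReturn (DVar 0)))
                                (drenc (upr Suc) N))))
          M)"

datatype 'l dectx =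
    DKHole
  | DKFrame "'l dectx" "'l dframe"
  | DKReset "'l dectx" "'l dcomp"

primrec dplug_ectx :: "'l dectx \<Rightarrow> 'l dcomp \<Rightarrow> 'l dcomp" where
  "dplug_ectx DKHole M = M"
| "dplug_ectx (DKFrame K B) M = dplug_ectx K (dplug_frame B M)"
| "dplug_ectx (DKReset K N) M = dplug_ectx K (DReset M N)"

inductive dred :: "'l dcomp \<Rightarrow> 'l dcomp \<Rightarrow> bool" where
  "dbeta M N \<Longrightarrow> dred (dplug_ectx K M) (dplug_ectx K N)"

section \<open>Monadic reflection\<close>

text \<open>
  The core constructs bind as above.  In \<open>MWhere Nu Nb\<close>, which is
  \<open>where {return x = Nu; y >>= f = Nb}\<close>, \<open>Nu\<close> is under the binder of \<open>x\<close>, and \<open>Nb\<close> is under the binders of \<open>y\<close> (index 1) and \<open>f\<close> (index 0).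
\<close>

datatype 'l mval =
    MVar nat
  | MUnit
  | MPair "'l mval" "'l mval"
  | MInj 'l "'l mval"
  | MThunk "'l mcomp"
and 'l mcomp =
    MSplit "'l mval" "'l mcomp"
  | MCase "'l mval" "('l, 'l mcomp) fmap"
  | MForce "'l mval"
  | MReturn "'l mval"
  | MLet "'l mcomp" "'l mcomp"
  | MLam "'l mcomp"
  | MApp "'l mcomp" "'l mval"
  | MWith "'l mcomp" "'l mcomp"
  | MPrj1 "'l mcomp"
  | MPrj2 "'l mcomp"
  | MReflect "'l mcomp"
  | MReify "'l mmonad" "'l mcomp"
and 'l mmonad =
    MWhere "'l mcomp" "'l mcomp"

primrec mrenv :: "(nat \<Rightarrow> nat) \<Rightarrow> 'l mval \<Rightarrow> 'l mval"
  and mrenc :: "(nat \<Rightarrow> nat) \<Rightarrow> 'l mcomp \<Rightarrow> 'l mcomp"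
  and mrent :: "(nat \<Rightarrow> nat) \<Rightarrow> 'l mmonad \<Rightarrow> 'l mmonad" where
  "mrenv r (MVar n) = MVar (r n)"
| "mrenv r MUnit = MUnit"
| "mrenv r (MPair V W) = MPair (mrenv r V) (mrenv r W)"
| "mrenv r (MInj l V) = MInj l (mrenv r V)"
| "mrenv r (MThunk M) = MThunk (mrenc r M)"
| "mrenc r (MSplit V M) = MSplit (mrenv r V) (mrenc (upr (upr r)) M)"
| "mrenc r (MCase V bs) = MCase (mrenv r V) (fmmap (mrenc (upr r)) bs)"
| "mrenc r (MForce V) = MForce (mrenv r V)"
| "mrenc r (MReturn V) = MReturn (mrenv r V)"
| "mrenc r (MLet M N) = MLet (mrenc r M) (mrenc (upr r) N)"
| "mrenc r (MLam M) = MLam (mrenc (upr r) M)"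
| "mrenc r (MApp M V) = MApp (mrenc r M) (mrenv r V)"
| "mrenc r (MWith M N) = MWith (mrenc r M) (mrenc r N)"
| "mrenc r (MPrj1 M) = MPrj1 (mrenc r M)"
| "mrenc r (MPrj2 M) = MPrj2 (mrenc r M)"
| "mrenc r (MReflect N) = MReflect (mrenc r N)"
| "mrenc r (MReify T M) = MReify (mrent r T) (mrenc r M)"
| "mrent r (MWhere Nu Nb) = MWhere (mrenc (upr r) Nu) (mrenc (upr (upr r)) Nb)"

definition mups :: "(nat \<Rightarrow> 'l mval) \<Rightarrow> nat \<Rightarrow> 'l mval" where
  "mups s = case_nat (MVar 0) (mrenv Suc \<circ> s)"

primrec msubstv :: "(nat \<Rightarrow> 'l mval) \<Rightarrow> 'l mval \<Rightarrow> 'l mval"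
  and msubstc :: "(nat \<Rightarrow> 'l mval) \<Rightarrow> 'l mcomp \<Rightarrow> 'l mcomp"
  and msubstt :: "(nat \<Rightarrow> 'l mval) \<Rightarrow> 'l mmonad \<Rightarrow> 'l mmonad" where
  "msubstv s (MVar n) = s n"
| "msubstv s MUnit = MUnit"
| "msubstv s (MPair V W) = MPair (msubstv s V) (msubstv s W)"
| "msubstv s (MInj l V) = MInj l (msubstv s V)"
| "msubstv s (MThunk M) = MThunk (msubstc s M)"
| "msubstc s (MSplit V M) = MSplit (msubstv s V) (msubstc (mups (mups s)) M)"
| "msubstc s (MCase V bs) = MCase (msubstv s V) (fmmap (msubstc (mups s)) bs)"
| "msubstc s (MForce V) = MForce (msubstv s V)"
| "msubstc s (MReturn V) = MReturn (msubstv s V)"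
| "msubstc s (MLet M N) = MLet (msubstc s M) (msubstc (mups s) N)"
| "msubstc s (MLam M) = MLam (msubstc (mups s) M)"
| "msubstc s (MApp M V) = MApp (msubstc s M) (msubstv s V)"
| "msubstc s (MWith M N) = MWith (msubstc s M) (msubstc s N)"
| "msubstc s (MPrj1 M) = MPrj1 (msubstc s M)"
| "msubstc s (MPrj2 M) = MPrj2 (msubstc s M)"
| "msubstc s (MReflect N) = MReflect (msubstc s N)"
| "msubstc s (MReify T M) = MReify (msubstt s T) (msubstc s M)"
| "msubstt s (MWhere Nu Nb) = MWhere (msubstc (mups s) Nu) (msubstc (mups (mups s)) Nb)"

definition msubst1 :: "'l mval \<Rightarrow> 'l mcomp \<Rightarrow> 'l mcomp" where
  "msubst1 V = msubstc (case_nat V MVar)"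

definition msubst2 :: "'l mval \<Rightarrow> 'l mval \<Rightarrow> 'l mcomp \<Rightarrow> 'l mcomp" where
  "msubst2 V W = msubstc (case_nat W (case_nat V MVar))"

datatype 'l mframe =
    MFLet "'l mcomp"
  | MFApp "'l mval"
  | MFPrj1
  | MFPrj2

primrec mplug_frame :: "'l mframe \<Rightarrow> 'l mcomp \<Rightarrow> 'l mcomp" where
  "mplug_frame (MFLet N) M = MLet M N"
| "mplug_frame (MFApp V) M = MApp M V"
| "mplug_frame MFPrj1 M = MPrj1 M"
| "mplug_frame MFPrj2 M = MPrj2 M"

primrec mren_frame :: "(nat \<Rightarrow> nat) \<Rightarrow> 'l mframe \<Rightarrow> 'l mframe" where
  "mren_frame r (MFLet N) = MFLet (mrenc (upr r) N)"
| "mren_frame r (MFApp V) = MFApp (mrenv r V)"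
| "mren_frame r MFPrj1 = MFPrj1"
| "mren_frame r MFPrj2 = MFPrj2"

datatype 'l mhoist = MHHole | MHFrame "'l mhoist" "'l mframe"

primrec mplug_hoist :: "'l mhoist \<Rightarrow> 'l mcomp \<Rightarrow> 'l mcomp" where
  "mplug_hoist MHHole M = M"
| "mplug_hoist (MHFrame H B) M = mplug_hoist H (mplug_frame B M)"

primrec mren_hoist :: "(nat \<Rightarrow> nat) \<Rightarrow> 'l mhoist \<Rightarrow> 'l mhoist" where
  "mren_hoist r MHHole = MHHole"
| "mren_hoist r (MHFrame H B) = MHFrame (mren_hoist r H) (mren_frame r B)"

inductive mbeta :: "'l mcomp \<Rightarrow> 'l mcomp \<Rightarrow> bool" where
  split: "mbeta (MSplit (MPair V W) M) (msubst2 V W M)"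
| case_of: "fmlookup bs l = Some M \<Longrightarrow> mbeta (MCase (MInj l V) bs) (msubst1 V M)"
| force: "mbeta (MForce (MThunk M)) M"
| let_return: "mbeta (MLet (MReturn V) N) (msubst1 V N)"
| app: "mbeta (MApp (MLam M) V) (msubst1 V M)"
| prj1: "mbeta (MPrj1 (MWith M N)) M"
| prj2: "mbeta (MPrj2 (MWith M N)) N"
| reify_return: "mbeta (MReify (MWhere Nu Nb) (MReturn V)) (msubst1 V Nu)"
| reify_reflect:
    "T = MWhere Nu Nb \<Longrightarrow>
     mbeta (MReify T (mplug_hoist H (MReflect N)))
       (msubst2
          (MThunk N)
          (MThunk (MLam (MReify (mrent Suc T)
                                (mplug_hoist (mren_hoist Suc H) (MReturn (MVar 0))))))
          Nb)"

text \<open>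
  The relation \<open>\<leadsto>\<close>, the least congruence-closed relation containing \<open>mbeta\<close>: one component for
  each syntactic category, and one rule for each argument position of each term former.
\<close>

inductive mstepv :: "'l mval \<Rightarrow> 'l mval \<Rightarrow> bool"
  and mstepc :: "'l mcomp \<Rightarrow> 'l mcomp \<Rightarrow> bool"
  and mstept :: "'l mmonad \<Rightarrow> 'l mmonad \<Rightarrow> bool" where
  beta: "mbeta M N \<Longrightarrow> mstepc M N"
| pair_l: "mstepv V V' \<Longrightarrow> mstepv (MPair V W) (MPair V' W)"
| pair_r: "mstepv W W' \<Longrightarrow> mstepv (MPair V W) (MPair V W')"
| inj: "mstepv V V' \<Longrightarrow> mstepv (MInj l V) (MInj l V')"
| thunk: "mstepc M M' \<Longrightarrow> mstepv (MThunk M) (MThunk M')"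
| split_val: "mstepv V V' \<Longrightarrow> mstepc (MSplit V M) (MSplit V' M)"
| split_body: "mstepc M M' \<Longrightarrow> mstepc (MSplit V M) (MSplit V M')"
| case_val: "mstepv V V' \<Longrightarrow> mstepc (MCase V bs) (MCase V' bs)"
| case_branch: "fmlookup bs l = Some M \<Longrightarrow> mstepc M M' \<Longrightarrow>
    mstepc (MCase V bs) (MCase V (fmupd l M' bs))"
| force: "mstepv V V' \<Longrightarrow> mstepc (MForce V) (MForce V')"
| return: "mstepv V V' \<Longrightarrow> mstepc (MReturn V) (MReturn V')"
| let_l: "mstepc M M' \<Longrightarrow> mstepc (MLet M N) (MLet M' N)"
| let_r: "mstepc N N' \<Longrightarrow> mstepc (MLet M N) (MLet M N')"
| lam: "mstepc M M' \<Longrightarrow> mstepc (MLam M) (MLam M')"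
| app_fun: "mstepc M M' \<Longrightarrow> mstepc (MApp M V) (MApp M' V)"
| app_arg: "mstepv V V' \<Longrightarrow> mstepc (MApp M V) (MApp M V')"
| with_l: "mstepc M M' \<Longrightarrow> mstepc (MWith M N) (MWith M' N)"
| with_r: "mstepc N N' \<Longrightarrow> mstepc (MWith M N) (MWith M N')"
| prj1: "mstepc M M' \<Longrightarrow> mstepc (MPrj1 M) (MPrj1 M')"
| prj2: "mstepc M M' \<Longrightarrow> mstepc (MPrj2 M) (MPrj2 M')"
| reflect: "mstepc N N' \<Longrightarrow> mstepc (MReflect N) (MReflect N')"
| reify_monad: "mstept T T' \<Longrightarrow> mstepc (MReify T M) (MReify T' M)"
| reify_body: "mstepc M M' \<Longrightarrow> mstepc (MReify T M) (MReify T M')"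
| where_return: "mstepc Nu Nu' \<Longrightarrow> mstept (MWhere Nu Nb) (MWhere Nu' Nb)"
| where_bind: "mstepc Nb Nb' \<Longrightarrow> mstept (MWhere Nu Nb) (MWhere Nu Nb')"

section \<open>The translation\<close>

text \<open>
  The monad \<open>where {return x = \<lambda>c. c! x; m >>= f = \<lambda>c. m! {\<lambda>y. f! y c}}\<close>.
  In the return clause, under \<open>\<lambda>c\<close>: \<open>c\<close> = 0, \<open>x\<close> = 1.  In the bind clause, under \<open>\<lambda>c\<close>:
  \<open>c\<close> = 0, \<open>f\<close> = 1, \<open>m\<close> = 2, and under the inner \<open>\<lambda>y\<close>: \<open>y\<close> = 0, \<open>c\<close> = 1, \<open>f\<close> = 2.
\<close>

definition Cont :: "'l mmonad" where
  "Cont = MWhere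
     (MLam (MApp (MForce (MVar 0)) (MVar 1)))
     (MLam (MApp (MForce (MVar 2))
                 (MThunk (MLam (MApp (MApp (MForce (MVar 2)) (MVar 0)) (MVar 1))))))"

primrec trv :: "'l dval \<Rightarrow> 'l mval"
  and trc :: "'l dcomp \<Rightarrow> 'l mcomp" where
  "trv (DVar n) = MVar n"
| "trv DUnit = MUnit"
| "trv (DPair V W) = MPair (trv V) (trv W)"
| "trv (DInj l V) = MInj l (trv V)"
| "trv (DThunk M) = MThunk (trc M)"
| "trc (DSplit V M) = MSplit (trv V) (trc M)"
| "trc (DCase V bs) = MCase (trv V) (fmmap trc bs)"
| "trc (DForce V) = MForce (trv V)"
| "trc (DReturn V) = MReturn (trv V)"
| "trc (DLet M N) = MLet (trc M) (trc N)"
| "trc (DLam M) = MLam (trc M)"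
| "trc (DApp M V) = MApp (trc M) (trv V)"
| "trc (DWith M N) = MWith (trc M) (trc N)"
| "trc (DPrj1 M) = MPrj1 (trc M)"
| "trc (DPrj2 M) = MPrj2 (trc M)"
| "trc (DShift0 M) = MReflect (MLam (trc M))"
| "trc (DReset M N) = MApp (MReify Cont (trc M)) (MThunk (MLam (trc N)))"

end

theory Submission
  imports Defs
begin

text \<open>
  A translated redex of the core or of the return clause is simulated step by step.  For a capture,
  the bind clause of \<open>Cont\<close> produces \<open>{\<lambda>k. M}! {\<lambda>y. {\<lambda>z. reify H[return z]}! y {\<lambda>x. N}}\<close>.  The
  administrative redex under \<open>\<lambda>y\<close>, which reduction under binders may contract, has to be
  contracted before the continuation is substituted for \<open>k\<close>, because \<open>k\<close> may occur any number of
  times.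
\<close>

section \<open>Renaming and substitution\<close>

lemma upr_simps [simp]: "upr r 0 = 0" "upr r (Suc n) = Suc (r n)"
  by (simp_all add: upr_def)

lemma mups_simps [simp]: "mups s 0 = MVar 0" "mups s (Suc n) = mrenv Suc (s n)"
  by (simp_all add: mups_def)

lemma mups_MVar_comp: "mups (MVar \<circ> r) = MVar \<circ> upr r"
proof
  show "mups (MVar \<circ> r) n = (MVar \<circ> upr r) n" for n
    by (cases n) simp_all
qed

lemma msubst_MVar_comp:
  fixes V :: "'l mval" and M :: "'l mcomp" and T :: "'l mmonad"
  shows "msubstv (MVar \<circ> r) V = mrenv r V"
    "msubstc (MVar \<circ> r) M = mrenc r M"
    "msubstt (MVar \<circ> r) T = mrent r T"
  by (induction V and M and T arbitrary: r and r and r)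
    (simp_all add: mups_MVar_comp cong: fmap.map_cong)

lemma mups_comp_upr: "mups s \<circ> upr r = mups (s \<circ> r)"
proof
  show "(mups s \<circ> upr r) n = mups (s \<circ> r) n" for n
    by (cases n) simp_all
qed

lemma msubst_mren:
  "msubstv s (mrenv r V) = msubstv (s \<circ> r) V"
  "msubstc s (mrenc r M) = msubstc (s \<circ> r) M"
  "msubstt s (mrent r T) = msubstt (s \<circ> r) T"
  by (induction V and M and T arbitrary: s r and s r and s r)
    (simp_all add: mups_comp_upr fmap.map_comp cong: fmap.map_cong)

lemma mups_MVar: "mups MVar = MVar"
proof
  show "mups MVar n = MVar n" for n
    by (cases n) simp_all
qed

lemma msubst_MVar:
  fixes V :: "'l mval" and M :: "'l mcomp" and T :: "'l mmonad"
  shows "msubstv MVar V = V"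
    "msubstc MVar M = M"
    "msubstt MVar T = T"
  by (induction V and M and T) (simp_all add: mups_MVar fmap.map_ident cong: fmap.map_cong)

lemma msubstv_shift: "msubstv (case_nat W MVar) (mrenv Suc V) = V"
proof -
  have "case_nat W MVar \<circ> Suc = MVar"
    by auto
  then show ?thesis
    by (simp add: msubst_mren msubst_MVar)
qed

text \<open>Needed when the beta step for \<open>c\<close> passes under the binder of
  \<open>y\<close>: of the two weakenings, the one for \<open>c\<close> cancels and the one for
  \<open>y\<close> stays.\<close>

lemma msubstv_mups_shift2:
  "msubstv (mups (case_nat W MVar)) (mrenv Suc (mrenv Suc V)) = mrenv Suc V"
proof -
  have "mups (case_nat W MVar) \<circ> Suc \<circ> Suc = MVar \<circ> Suc"
    by auto
  then show ?thesis
    by (simp add: msubst_mren msubst_MVar_comp)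
qed

text \<open>Contracts the administrative redex: moving the body under a new binder and then
  substituting that binder's variable compose to \<open>MVar\<close>.\<close>

lemma msubst1_MVar_shift:
  fixes M :: "'l mcomp"
  shows "msubst1 (MVar 0) (mrenc (upr Suc) M) = M"
proof -
  have "case_nat (MVar 0) MVar \<circ> upr Suc = (MVar :: nat \<Rightarrow> 'l mval)"
  proof
    show "(case_nat (MVar 0) MVar \<circ> upr Suc) n = (MVar n :: 'l mval)" for n
      by (cases n) simp_all
  qed
  then show ?thesis
    by (simp add: msubst1_def msubst_mren msubst_MVar)
qed

text \<open>\<open>Cont\<close> is closed. Writing 2 as \<open>Suc (Suc 0)\<close> lets the rules
  for \<open>upr\<close> reach its largest index.\<close>

lemma mrent_Cont: "mrent r Cont = Cont"
  by (simp add: Cont_def numeral_2_eq_2)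

lemma msubstt_Cont: "msubstt s Cont = Cont"
  by (simp add: Cont_def numeral_2_eq_2)

section \<open>The translation commutes with renaming and substitution\<close>

text \<open>Every source binder becomes exactly one target binder, and the inserted
  \<open>Cont\<close> is closed, so the translation adjusts no index.\<close>

lemma tr_dren:
  fixes V :: "'l dval" and M :: "'l dcomp"
  shows "trv (drenv r V) = mrenv r (trv V)"
    "trc (drenc r M) = mrenc r (trc M)"
  by (induction V and M arbitrary: r and r)
    (simp_all add: mrent_Cont fmap.map_comp cong: fmap.map_cong)

lemma trv_comp_dups: "trv \<circ> dups s = mups (trv \<circ> s)"
proof
  show "(trv \<circ> dups s) n = mups (trv \<circ> s) n" for n
    by (cases n) (simp_all add: dups_def tr_dren)
qed

lemma tr_dsubst:
  "trv (dsubstv s V) = msubstv (trv \<circ> s) (trv V)"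
  "trc (dsubstc s M) = msubstc (trv \<circ> s) (trc M)"
  by (induction V and M arbitrary: s and s)
    (simp_all add: trv_comp_dups msubstt_Cont fmap.map_comp cong: fmap.map_cong)

lemma trv_comp_case_nat: "trv \<circ> case_nat V s = case_nat (trv V) (trv \<circ> s)"
  by (auto split: nat.split)

lemma trv_comp_DVar: "trv \<circ> DVar = MVar"
  by auto

lemma trc_dsubst1: "trc (dsubst1 V M) = msubst1 (trv V) (trc M)"
  by (simp add: dsubst1_def msubst1_def tr_dsubst trv_comp_case_nat trv_comp_DVar)

lemma trc_dsubst2: "trc (dsubst2 V W M) = msubst2 (trv V) (trv W) (trc M)"
  by (simp add: dsubst2_def msubst2_def tr_dsubst trv_comp_case_nat trv_comp_DVar)

section \<open>Translation of contexts\<close>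

primrec tr_frame :: "'l dframe \<Rightarrow> 'l mframe" where
  "tr_frame (DFLet N) = MFLet (trc N)"
| "tr_frame (DFApp V) = MFApp (trv V)"
| "tr_frame DFPrj1 = MFPrj1"
| "tr_frame DFPrj2 = MFPrj2"

primrec tr_hoist :: "'l dhoist \<Rightarrow> 'l mhoist" where
  "tr_hoist DHHole = MHHole"
| "tr_hoist (DHFrame H B) = MHFrame (tr_hoist H) (tr_frame B)"

lemma trc_dplug_frame: "trc (dplug_frame B M) = mplug_frame (tr_frame B) (trc M)"
  by (cases B) simp_all

lemma trc_dplug_hoist: "trc (dplug_hoist H M) = mplug_hoist (tr_hoist H) (trc M)"
  by (induction H arbitrary: M) (simp_all add: trc_dplug_frame)

lemma tr_dren_frame: "tr_frame (dren_frame r B) = mren_frame r (tr_frame B)"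
  by (cases B) (simp_all add: tr_dren)

lemma tr_dren_hoist: "tr_hoist (dren_hoist r H) = mren_hoist r (tr_hoist H)"
  by (induction H) (simp_all add: tr_dren_frame)

lemma mstepc_mplug_frame: "mstepc M N \<Longrightarrow> mstepc (mplug_frame B M) (mplug_frame B N)"
  by (cases B) (auto intro: mstepv_mstepc_mstept.intros)

lemma tranclp_cong_map:
  assumes "r\<^sup>+\<^sup>+ x y" and "\<And>x y. r x y \<Longrightarrow> r (f x) (f y)"
  shows "r\<^sup>+\<^sup>+ (f x) (f y)"
  using assms(1) by induction (auto intro: assms(2) tranclp.trancl_into_trancl)

text \<open>A reset becomes an application around a reify, so its frame needs two congruence rules.
  The terms are generalized because the induction moves the innermost frame into them.\<close>

lemma mstepc_trc_dplug_ectx: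
  assumes "mstepc\<^sup>+\<^sup>+ (trc M) (trc N)"
  shows "mstepc\<^sup>+\<^sup>+ (trc (dplug_ectx K M)) (trc (dplug_ectx K N))"
  using assms
proof (induction K arbitrary: M N)
  case DKHole
  then show ?case by simp
next
  case (DKFrame K B)
  have "mstepc\<^sup>+\<^sup>+ (mplug_frame (tr_frame B) (trc M)) (mplug_frame (tr_frame B) (trc N))"
    using DKFrame.prems by (rule tranclp_cong_map) (rule mstepc_mplug_frame)
  then show ?case
    by (simp add: DKFrame.IH trc_dplug_frame)
next
  case (DKReset K L)
  let ?f = "\<lambda>M. MApp (MReify Cont M) (MThunk (MLam (trc L)))"
  have "mstepc\<^sup>+\<^sup>+ (?f (trc M)) (?f (trc N))"
    using DKReset.prems by (rule tranclp_cong_map) (intro app_fun reify_body)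
  then show ?case
    by (simp add: DKReset.IH)
qed

section \<open>Simulation of the control rules\<close>

text \<open>Four steps: the return clause, passing the continuation as \<open>c\<close>, forcing it,
  and applying it to \<open>V\<close>.\<close>

lemma reify_Cont_return:
  "mstepc\<^sup>+\<^sup>+ (MApp (MReify Cont (MReturn V)) (MThunk (MLam N))) (msubst1 V N)"
proof -
  let ?c = "MThunk (MLam N)"
  have "mbeta (MReify Cont (MReturn V)) (msubst1 V (MLam (MApp (MForce (MVar 0)) (MVar 1))))"
    unfolding Cont_def by (rule mbeta.reify_return)
  then have "mstepc (MApp (MReify Cont (MReturn V)) ?c)
      (MApp (MLam (MApp (MForce (MVar 0)) (mrenv Suc V))) ?c)"
    by (intro app_fun beta) (simp add: msubst1_def)
  also have "mstepc\<^sup>+\<^sup>+ \<dots> (MApp (MForce ?c) V)"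
    using mbeta.app[of "MApp (MForce (MVar 0)) (mrenv Suc V)" ?c]
    by (intro tranclp.r_into_trancl beta) (simp add: msubst1_def msubstv_shift)
  also have "mstepc \<dots> (MApp (MLam N) V)"
    by (intro app_fun beta mbeta.force)
  also have "mstepc \<dots> (msubst1 V N)"
    by (intro beta mbeta.app)
  finally show ?thesis .
qed

lemma reify_Cont_reflect:
  defines "R H \<equiv> MReify Cont (mplug_hoist (mren_hoist Suc H) (MReturn (MVar 0)))"
  shows "mstepc\<^sup>+\<^sup>+
    (MApp (MReify Cont (mplug_hoist H (MReflect (MLam M)))) (MThunk (MLam N)))
    (msubst1 (MThunk (MLam (MApp (R H) (MThunk (MLam (mrenc (upr Suc) N)))))) M)"
proof -
  let ?c = "MThunk (MLam N)" and ?m = "MThunk (MLam M)" and ?f = "MThunk (MLam (R H))"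
  let ?k = "\<lambda>L c. MThunk (MLam (MApp L c))"
  \<comment> \<open>The instantiated bind clause: \<open>?m\<close> lies under \<open>c\<close>, and
    \<open>?f\<close> under \<open>c\<close> and \<open>y\<close>, which fixes the number of
    weakenings.\<close>
  let ?b = "MApp (MForce (mrenv Suc ?m))
    (?k (MApp (MForce (mrenv Suc (mrenv Suc ?f))) (MVar 0)) (MVar 1))"
  \<comment> \<open>This position, inside a thunk and under a binder, is in no evaluation context;
    only the congruence closure reaches it.\<close>
  have cong: "mstepc (MApp (MForce ?m) (?k L c)) (MApp (MForce ?m) (?k L' c))"
    if "mstepc L L'" for L L' c
    using that by (intro app_arg thunk lam app_fun)
  \<comment> \<open>Renamings of thunks stay folded, so that \<open>msubstv_shift\<close> and
    \<open>msubstv_mups_shift2\<close> can cancel them after the next step.\<close>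
  have "mbeta (MReify Cont (mplug_hoist H (MReflect (MLam M)))) (MLam ?b)"
    using mbeta.reify_reflect[OF Cont_def, of H "MLam M"]
    by (simp add: msubst2_def R_def mrent_Cont numeral_2_eq_2 del: mrenv.simps(5))
  then have "mstepc\<^sup>+\<^sup>+ (MApp (MReify Cont (mplug_hoist H (MReflect (MLam M)))) ?c)
      (MApp (MLam ?b) ?c)"
    by (intro tranclp.r_into_trancl app_fun beta)
  also have "mstepc \<dots> (MApp (MForce ?m)
      (?k (MApp (MForce (mrenv Suc ?f)) (MVar 0)) (mrenv Suc ?c)))"
    using mbeta.app[of ?b ?c]
    by (intro beta)
      (simp add: msubst1_def msubstv_shift msubstv_mups_shift2 del: mrenv.simps(5))
  also have "mstepc \<dots> (MApp (MForce ?m)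
      (?k (MApp (MLam (mrenc (upr Suc) (R H))) (MVar 0)) (mrenv Suc ?c)))"
    \<comment> \<open>Now \<open>simp\<close> pushes the weakening into \<open>?f\<close>, which
      exposes the force redex.\<close>
    by (simp, intro cong app_fun beta mbeta.force)
  also have "mstepc \<dots> (MApp (MForce ?m) (?k (R H) (mrenv Suc ?c)))"
    using mbeta.app[of "mrenc (upr Suc) (R H)" "MVar 0"]
    by (intro cong beta) (simp add: msubst1_MVar_shift)
  also have "mstepc \<dots> (MApp (MLam M) (?k (R H) (mrenv Suc ?c)))"
    by (intro app_fun beta mbeta.force)
  also have "mstepc \<dots> (msubst1 (?k (R H) (mrenv Suc ?c)) M)"
    by (intro beta mbeta.app)
  finally show ?thesis
    by simp
qed

lemma dbeta_simulation:
  assumes "dbeta M N"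
  shows "mstepc\<^sup>+\<^sup>+ (trc M) (trc N)"
  using assms
proof cases
  case (reset_return V L)
  then show ?thesis
    by (simp add: trc_dsubst1 reify_Cont_return)
next
  case (reset_shift0 H L P)
  then show ?thesis
    using reify_Cont_reflect[of "tr_hoist H" "trc L" "trc P"]
    by (simp add: trc_dsubst1 trc_dplug_hoist tr_dren_hoist tr_dren)
\<comment> \<open>A core redex translates to a redex of the same rule, so one step suffices.\<close>
qed (auto simp: trc_dsubst1 trc_dsubst2
    intro!: tranclp.r_into_trancl beta intro: mbeta.intros)

theorem theorem6p1:
  fixes M N :: "'l dcomp"
  assumes "dred M N"
  shows "mstepc\<^sup>+\<^sup>+ (trc M) (trc N)"
  using assms by cases (auto intro: mstepc_trc_dplug_ectx dbeta_simulation)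

end
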